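(* Let $G$ be a directed graph with $N$ nodes, let $d$ be a positive integer, let $k$ be a node of $G$ and let $W$ be a walk in $G$ containing node $k$. Then the $(d,k)$-reduction of $W$ satisfies \[ \ell\big(\mathrm{Red}_{d,k}(W)\big) \le (d-1) + 2d\,(N-1). \]
   Context: A walk is a finite sequence of consecutive edges with a start and end node (possibly empty); $\ell(W)$ is its number of edges, $\cdot$ denotes concatenation, a node of $W$ is the end node of some prefix of $W$. A cycle is a closed walk containing no nonempty closed walk as a proper subwalk. A cycle pattern of a walk $W$ is a finite, possibly empty, sequence $\mathcal{S}=(C_1,\dots,C_m)$ of nonempty cycles such that $W=U_0\cdot C_1\cdot U_1\cdots C_m\cdot U_m$ for some walks $U_0,\dots,U_m$ (one such decomposition being fixed by an arbitrary fixed choice function); then $\mathrm{Rem}(W,\mathcal{S})=U_0\cdot U_1\cdots U_m$ and $\ell(\mathcal{S})=\sum_r\ell(C_r)$. For a node $k$ of $W$, $\mathbf{S}_k(W)$ is the set of cycle patterns $\mathcal{S}$ of $W$ such that $k$ is a node of $\mathrm{Rem}(W,\mathcal{S})$, and $\mathbf{S}_{d,k}(W)$ the set of those $\mathcal{S}\in\mathbf{S}_k(W)$ with $\ell(\mathcal{S})\equiv 0\pmod d$ (it contains the empty pattern). $\mathrm{Step}_{d,k}(W)=\mathrm{Rem}(W,\mathcal{S})$ for some $\mathcal{S}\in\mathbf{S}_{d,k}(W)$ of maximal $\ell(\mathcal{S})$ (chosen by a fixed choice function), and $\mathrm{Red}_{d,k}(W)=\lim_{t\to\infty}\mathrm{Step}_{d,k}^t(W)$,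 the iterates being eventually stationary. *)

theory Defs
  imports
    Complex_Main
    "HOL-Number_Theory.Cong"
    "Graph_Theory.Pair_Digraph"
begin

text \<open>
  A walk is stored as its start node together with its list of arcs, so that an empty walk
  still has a start node and an end node. \<open>wconcat\<close> is total; that its arguments are walks
  which can actually be concatenated is part of \<open>is_concat\<close>.
\<close>

type_synonym ('a, 'b) walk = "'a \<times> 'b awalk"

definition wstart :: "('a, 'b) walk \<Rightarrow> 'a" where
  "wstart W = fst W"

definition wlen :: "('a, 'b) walk \<Rightarrow> nat" where
  "wlen W = length (snd W)"

definition wconcat :: "('a, 'b) walk list \<Rightarrow> ('a, 'b) walk" where
  "wconcat Vs = (fst (hd Vs), concat (map snd Vs))"

definition pattern_len :: "('a, 'b) walk list \<Rightarrow> nat" where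
  "pattern_len S = (\<Sum>C\<leftarrow>S. wlen C)"

context pre_digraph
begin

definition wend :: "('a, 'b) walk \<Rightarrow> 'a" where
  "wend W = awlast (fst W) (snd W)"

definition is_walk :: "('a, 'b) walk \<Rightarrow> bool" where
  "is_walk W \<longleftrightarrow> awalk (wstart W) (snd W) (wend W)"

definition is_concat :: "('a, 'b) walk \<Rightarrow> ('a, 'b) walk list \<Rightarrow> bool" where
  "is_concat W Vs \<longleftrightarrow> Vs \<noteq> [] \<and> (\<forall>V\<in>set Vs. is_walk V) \<and>
     successively (\<lambda>V V'. wend V = wstart V') Vs \<and> W = wconcat Vs"

definition nodes :: "('a, 'b) walk \<Rightarrow> 'a set" where
  "nodes W = {wend P | P Q. is_concat W [P, Q]}"

definition subwalk :: "('a, 'b) walk \<Rightarrow> ('a, 'b) walk \<Rightarrow> bool" where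
  "subwalk V W \<longleftrightarrow> (\<exists>A B. is_concat W [A, V, B])"

definition is_closed :: "('a, 'b) walk \<Rightarrow> bool" where
  "is_closed W \<longleftrightarrow> is_walk W \<and> wstart W = wend W"

text \<open>
  Not the library's \<^const>\<open>cycle\<close>: here the empty walks count as cycles.
\<close>

definition is_cycle :: "('a, 'b) walk \<Rightarrow> bool" where
  "is_cycle C \<longleftrightarrow> is_closed C \<and>
     \<not> (\<exists>V. subwalk V C \<and> V \<noteq> C \<and> is_closed V \<and> wlen V > 0)"

text \<open>
  \<open>Us = [U\<^sub>0, \<dots>, U\<^sub>m]\<close> and \<open>S = [C\<^sub>1, \<dots>, C\<^sub>m]\<close> with \<open>W = U\<^sub>0 \<cdot> C\<^sub>1 \<cdot> U\<^sub>1 \<cdots> C\<^sub>m \<cdot> U\<^sub>m\<close>; given the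
  length condition, \<open>splice Us S = [U\<^sub>0, C\<^sub>1, U\<^sub>1, \<dots>, C\<^sub>m, U\<^sub>m]\<close>.
\<close>

definition decomposes :: "('a, 'b) walk \<Rightarrow> ('a, 'b) walk list \<Rightarrow> ('a, 'b) walk list \<Rightarrow> bool" where
  "decomposes W S Us \<longleftrightarrow> length Us = Suc (length S) \<and> is_concat W (splice Us S)"

definition cycle_pattern :: "('a, 'b) walk \<Rightarrow> ('a, 'b) walk list \<Rightarrow> bool" where
  "cycle_pattern W S \<longleftrightarrow> (\<forall>C\<in>set S. is_cycle C \<and> wlen C > 0) \<and> (\<exists>Us. decomposes W S Us)"

text \<open>The choice of a decomposition for every cycle pattern of every walk.\<close>

definition decomp_choice ::
    "(('a, 'b) walk \<Rightarrow> ('a, 'b) walk list \<Rightarrow> ('a, 'b) walk list) \<Rightarrow> bool" where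
  "decomp_choice D \<longleftrightarrow> (\<forall>W S. is_walk W \<longrightarrow> cycle_pattern W S \<longrightarrow> decomposes W S (D W S))"

end

definition Rem ::
    "(('a, 'b) walk \<Rightarrow> ('a, 'b) walk list \<Rightarrow> ('a, 'b) walk list) \<Rightarrow>
     ('a, 'b) walk \<Rightarrow> ('a, 'b) walk list \<Rightarrow> ('a, 'b) walk" where
  "Rem D W S = wconcat (D W S)"

context pre_digraph
begin

definition patterns_at ::
    "(('a, 'b) walk \<Rightarrow> ('a, 'b) walk list \<Rightarrow> ('a, 'b) walk list) \<Rightarrow>
     'a \<Rightarrow> ('a, 'b) walk \<Rightarrow> ('a, 'b) walk list set" where
  "patterns_at D k W = {S. cycle_pattern W S \<and> k \<in> nodes (Rem D W S)}"

definition patterns_mod_at ::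
    "(('a, 'b) walk \<Rightarrow> ('a, 'b) walk list \<Rightarrow> ('a, 'b) walk list) \<Rightarrow>
     nat \<Rightarrow> 'a \<Rightarrow> ('a, 'b) walk \<Rightarrow> ('a, 'b) walk list set" where
  "patterns_mod_at D d k W = {S \<in> patterns_at D k W. [pattern_len S = 0] (mod d)}"

text \<open>The choice of a pattern of maximal length, given the choice \<open>D\<close> of decompositions.\<close>

definition pattern_choice ::
    "(('a, 'b) walk \<Rightarrow> ('a, 'b) walk list \<Rightarrow> ('a, 'b) walk list) \<Rightarrow>
     (nat \<Rightarrow> 'a \<Rightarrow> ('a, 'b) walk \<Rightarrow> ('a, 'b) walk list) \<Rightarrow> bool" where
  "pattern_choice D M \<longleftrightarrow> (\<forall>d k W. d > 0 \<longrightarrow> is_walk W \<longrightarrow> k \<in> nodes W \<longrightarrow>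
     is_arg_max pattern_len (\<lambda>S. S \<in> patterns_mod_at D d k W) (M d k W))"

end

definition Step ::
    "(('a, 'b) walk \<Rightarrow> ('a, 'b) walk list \<Rightarrow> ('a, 'b) walk list) \<Rightarrow>
     (nat \<Rightarrow> 'a \<Rightarrow> ('a, 'b) walk \<Rightarrow> ('a, 'b) walk list) \<Rightarrow>
     nat \<Rightarrow> 'a \<Rightarrow> ('a, 'b) walk \<Rightarrow> ('a, 'b) walk" where
  "Step D M d k W = Rem D W (M d k W)"

text \<open>
  The limit of the iterates is their eventual constant value; that it exists for the walks
  in question is \<open>Red_stationary\<close> below.
\<close>

definition Red ::
    "(('a, 'b) walk \<Rightarrow> ('a, 'b) walk list \<Rightarrow> ('a, 'b) walk list) \<Rightarrow>
     (nat \<Rightarrow> 'a \<Rightarrow> ('a, 'b) walk \<Rightarrow> ('a, 'b) walk list) \<Rightarrow>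
     nat \<Rightarrow> 'a \<Rightarrow> ('a, 'b) walk \<Rightarrow> ('a, 'b) walk" where
  "Red D M d k W = (THE R. \<forall>\<^sub>F t in sequentially. (Step D M d k ^^ t) W = R)"


subsection \<open>Well-definedness\<close>

lemma wlen_splice: "length (concat (map snd (splice Us S)))
    = length (concat (map snd Us)) + pattern_len S"
  by (induction Us S rule: splice.induct) (auto simp: pattern_len_def wlen_def length_concat comp_def)

context wf_digraph
begin

lemma is_walk_append:
  assumes "is_walk V" "is_walk V'" "wend V = wstart V'"
  shows "is_walk (fst V, snd V @ snd V')" "wend (fst V, snd V @ snd V') = wend V'"
proof -
  have "awalk (fst V) (snd V @ snd V') (wend V')"
    using assms unfolding is_walk_def wstart_def by (metis awalk_appendI)
  then show "wend (fst V, snd V @ snd V') = wend V'" "is_walk (fst V, snd V @ snd V')"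
    by (auto simp: wend_def is_walk_def wstart_def)
qed

lemma is_walk_wconcat:
  assumes "Vs \<noteq> []" "\<forall>V\<in>set Vs. is_walk V" "successively (\<lambda>V V'. wend V = wstart V') Vs"
  shows "is_walk (wconcat Vs) \<and> wend (wconcat Vs) = wend (last Vs)"
  using assms
proof (induction Vs)
  case (Cons V Vs)
  show ?case
  proof (cases "Vs = []")
    case True
    then show ?thesis using Cons.prems by (simp add: wconcat_def)
  next
    case False
    then have "is_walk (wconcat Vs) \<and> wend (wconcat Vs) = wend (last Vs)"
      using Cons by (auto simp: successively_Cons)
    moreover have "wend V = wstart (wconcat Vs)"
      using False Cons.prems by (auto simp: successively_Cons wconcat_def wstart_def)
    ultimately show ?thesis
      using is_walk_append[of V "wconcat Vs"] Cons.prems False by (simp add: wconcat_def)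
  qed
qed simp

lemma splice_skip:
  assumes "length Us = Suc (length S)" "\<forall>C\<in>set S. is_closed C"
    "successively (\<lambda>V V'. wend V = wstart V') (splice Us S)"
  shows "successively (\<lambda>V V'. wend V = wstart V') Us"
  using assms
proof (induction S arbitrary: Us)
  case Nil
  then show ?case by (auto simp: length_Suc_conv)
next
  case (Cons C S)
  then obtain U U' Us' where "Us = U # U' # Us'" "length Us' = length S"
    by (auto simp: length_Suc_conv)
  then show ?case using Cons.IH[of "U' # Us'"] Cons.prems
    by (auto simp: is_closed_def successively_Cons)
qed

lemma set_splice_subset: "set Us \<subseteq> set (splice Us S)"
  using set_shuffles[OF splice_in_shuffles[of Us S]] by blast

lemma Rem_is_walk:
  assumes "decomp_choice D" "is_walk W" "cycle_pattern W S"
  shows "is_walk (Rem D W S)" "wlen (Rem D W S) + pattern_len S = wlen W"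
proof -
  have *: "decomposes W S (D W S)" using assms unfolding decomp_choice_def by blast
  have c: "\<forall>C\<in>set S. is_closed C" using assms(3) by (auto simp: cycle_pattern_def is_cycle_def)
  have "D W S \<noteq> []" using * by (auto simp: decomposes_def)
  moreover have "\<forall>V\<in>set (D W S). is_walk V"
    using * set_splice_subset[of "D W S" S] by (auto simp: decomposes_def is_concat_def)
  moreover have "successively (\<lambda>V V'. wend V = wstart V') (D W S)"
    using * c splice_skip by (auto simp: decomposes_def is_concat_def)
  ultimately show "is_walk (Rem D W S)" using is_walk_wconcat by (simp add: Rem_def)
  show "wlen (Rem D W S) + pattern_len S = wlen W"
    using * wlen_splice[of "D W S" S]
    by (metis decomposes_def is_concat_def Rem_def wlen_def wconcat_def snd_conv)
qed

lemma decomposes_Nil_iff: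
  assumes "is_walk W"
  shows "decomposes W [] Us \<longleftrightarrow> Us = [W]"
  using assms by (cases W) (auto simp: decomposes_def is_concat_def wconcat_def length_Suc_conv)

lemma Nil_in_patterns_mod_at:
  assumes "decomp_choice D" "is_walk W" "k \<in> nodes W"
  shows "Rem D W [] = W" "[] \<in> patterns_mod_at D d k W"
proof -
  have c: "cycle_pattern W []" using assms(2) by (simp add: cycle_pattern_def decomposes_Nil_iff)
  then have "D W [] = [W]" using assms(1,2) decomposes_Nil_iff unfolding decomp_choice_def by blast
  then show r: "Rem D W [] = W" by (simp add: Rem_def wconcat_def)
  show "[] \<in> patterns_mod_at D d k W"
    using c r assms(3) by (simp add: patterns_mod_at_def patterns_at_def pattern_len_def)
qed

lemma ex_decomp_choice: "\<exists>D. decomp_choice D"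
proof
  show "decomp_choice (\<lambda>W S. SOME Us. decomposes W S Us)"
    by (auto simp: decomp_choice_def cycle_pattern_def intro: someI)
qed

lemma ex_pattern_choice:
  assumes "decomp_choice D"
  shows "\<exists>M. pattern_choice D M"
proof -
  have "\<exists>S. is_arg_max pattern_len (\<lambda>S. S \<in> patterns_mod_at D d k W) S"
    if W: "is_walk W" "k \<in> nodes W" for d k W
  proof -
    have "\<forall>S. S \<in> patterns_mod_at D d k W \<longrightarrow> pattern_len S < Suc (wlen W)"
      using Rem_is_walk(2)[OF assms W(1)]
      by (fastforce simp: patterns_mod_at_def patterns_at_def)
    then obtain S where "S \<in> patterns_mod_at D d k W"
      "\<forall>T. T \<in> patterns_mod_at D d k W \<longrightarrow> pattern_len T \<le> pattern_len S"
      using ex_has_greatest_nat[of "\<lambda>S. S \<in> patterns_mod_at D d k W" "[]" pattern_len "Suc (wlen W)"]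
        Nil_in_patterns_mod_at(2)[OF assms W] by auto
    then show ?thesis by (auto simp: is_arg_max_linorder)
  qed
  then have "pattern_choice D (\<lambda>d k W. SOME S.
      is_arg_max pattern_len (\<lambda>S. S \<in> patterns_mod_at D d k W) S)"
    by (auto simp: pattern_choice_def intro: someI_ex)
  then show ?thesis by blast
qed

lemma Step_props:
  assumes "decomp_choice D" "pattern_choice D M" "d > 0" "is_walk W" "k \<in> nodes W"
  shows "is_walk (Step D M d k W)" "k \<in> nodes (Step D M d k W)"
    "Step D M d k W = W \<or> wlen (Step D M d k W) < wlen W"
proof -
  let ?S = "M d k W"
  have S: "cycle_pattern W ?S" "k \<in> nodes (Rem D W ?S)"
    using assms unfolding pattern_choice_def is_arg_max_def patterns_mod_at_def patterns_at_def
    by blast+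
  show "is_walk (Step D M d k W)" "k \<in> nodes (Step D M d k W)"
    using Rem_is_walk(1)[OF assms(1,4) S(1)] S(2) by (auto simp: Step_def)
  show "Step D M d k W = W \<or> wlen (Step D M d k W) < wlen W"
  proof (cases "?S = []")
    case True
    then show ?thesis using Nil_in_patterns_mod_at(1) assms by (simp add: Step_def)
  next
    case False
    then have "pattern_len ?S > 0"
      using S(1) by (cases ?S) (auto simp: pattern_len_def cycle_pattern_def)
    then show ?thesis using Rem_is_walk(2)[OF assms(1,4) S(1)] by (simp add: Step_def)
  qed
qed

lemma Red_stationary:
  assumes "decomp_choice D" "pattern_choice D M" "d > 0" "is_walk W" "k \<in> nodes W"
  shows "\<forall>\<^sub>F t in sequentially. (Step D M d k ^^ t) W = Red D M d k W"
proof -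
  have "\<exists>R. \<forall>\<^sub>F t in sequentially. (Step D M d k ^^ t) W = R"
    using assms(4,5)
  proof (induction "wlen W" arbitrary: W rule: less_induct)
    case less
    let ?W = "Step D M d k W"
    note p = Step_props[OF assms(1-3) less.prems]
    show ?case
    proof (cases "?W = W")
      case True
      then have "(Step D M d k ^^ t) W = W" for t by (induction t) auto
      then show ?thesis by auto
    next
      case False
      then obtain R where "\<forall>\<^sub>F t in sequentially. (Step D M d k ^^ t) ?W = R"
        using less.hyps p by blast
      then have "\<forall>\<^sub>F t in sequentially. (Step D M d k ^^ Suc t) W = R"
        by (simp only: funpow_Suc_right o_apply)
      then show ?thesis using eventually_sequentially_Suc by blast
    qed
  qed
  then obtain R where R: "\<forall>\<^sub>F t in sequentially. (Step D M d k ^^ t) W = R" by blast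
  have "R' = R" if "\<forall>\<^sub>F t in sequentially. (Step D M d k ^^ t) W = R'" for R'
    using eventually_happens'[OF sequentially_bot eventually_conj[OF that R]] by auto
  then have "Red D M d k W = R" unfolding Red_def using R by (rule the_equality[rotated])
  then show ?thesis using R by simp
qed

end

end

theory Submission
  imports Defs "HOL-Library.Sublist"
begin

text \<open>
  Split a stationary walk at an occurrence of \<open>k\<close>. Any \<open>N\<close> consecutive arcs contain a cycle, so if
  the walk had \<open>d N + N - 1\<close> arcs or more, the two parts would together contain \<open>d\<close> disjoint
  nonempty cycles, none of which crosses the chosen occurrence of \<open>k\<close>. By the pigeonhole principle
  on partial sums, some nonempty subfamily has total length divisible by \<open>d\<close>, and removing it keeps
  \<open>k\<close>: a contradiction. This gives length at most \<open>d N + N - 2\<close>, and the claimed bound exceeds this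
  by \<open>(d - 1) (N - 1)\<close>. The choice of decomposition is harmless, since the nodes of what remains
  only depend on the start node and on the multiset of removed arcs.
\<close>

section \<open>Counting arguments for lists and quotients\<close>

text \<open>The \<open>d + 1\<close> prefixes of \<open>xs\<close>, the empty one included, have
  sums in only \<open>d\<close> residue classes; the block between two congruent prefixes is a
  suitable \<open>ys\<close>.\<close>

lemma ex_subseq_sum_dvd:
  fixes f :: "'c \<Rightarrow> nat"
  assumes "d > 0" "length xs = d"
  shows "\<exists>ys. subseq ys xs \<and> ys \<noteq> [] \<and> d dvd sum_list (map f ys)"
proof -
  let ?g = "\<lambda>i. sum_list (map f (take i xs)) mod d"
  have "card (?g ` {..d}) \<le> card {..<d}"
    using assms(1) by (intro card_mono) auto
  then have "\<not> inj_on ?g {..d}"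
    using card_image[of ?g "{..d}"] by auto
  then obtain i j where ij: "i < j" "j \<le> d" "?g i = ?g j"
    unfolding inj_on_def by (metis atMost_iff linorder_neqE_nat)
  let ?ys = "drop i (take j xs)"
  have split: "take j xs = take i xs @ ?ys"
    using ij(1) by (metis append_take_drop_id min.absorb1 less_imp_le take_take)
  have sum: "sum_list (map f (take j xs)) = sum_list (map f (take i xs)) + sum_list (map f ?ys)"
    by (subst split) (simp only: map_append sum_list_append)
  have "d dvd sum_list (map f ?ys)"
    using mod_eq_dvd_iff_nat[of "sum_list (map f (take i xs))" "sum_list (map f (take j xs))" d]
      ij(3) sum by simp
  moreover have "subseq ?ys xs"
    by (meson subseq_order.trans sublist_imp_subseq sublist_drop sublist_take)
  moreover have "?ys \<noteq> []" using ij assms by simp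
  ultimately show ?thesis by blast
qed

text \<open>Lets two decompositions with the same pattern be compared by cancelling the arcs of the
  pattern.\<close>

lemma mset_concat_splice:
  "mset (concat (map f (splice xs ys))) = mset (concat (map f xs)) + mset (concat (map f ys))"
  by (induction xs ys rule: splice.induct) auto

text \<open>Rounding loses at most \<open>N - 1\<close> in each quotient. For positive
  \<open>d\<close>, quotients with sum at most \<open>d - 1\<close> would thus give
  \<open>a + b\<close> at most \<open>N * (d - 1) + 2 * (N - 1)\<close>, below the assumed
  bound.\<close>

lemma le_div_add_div:
  fixes d N a b :: nat
  assumes "N > 0" "d + 2 * d * (N - 1) \<le> a + b"
  shows "d \<le> a div N + b div N"
proof (cases d)
  case (Suc e)
  obtain n where n: "N = Suc n" using assms(1) gr0_implies_Suc by blast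
  show ?thesis
  proof (rule ccontr)
    assume "\<not> ?thesis"
    then have "N * (a div N + b div N) \<le> N * e" using Suc by simp
    moreover have "a mod N \<le> n" "b mod N \<le> n" using n by (simp_all add: less_Suc_eq_le[symmetric])
    moreover have "N * (a div N + b div N) + a mod N + b mod N = a + b"
      by (simp add: distrib_left add.assoc add.left_commute[of _ "a mod N"])
    ultimately have "a + b \<le> N * e + 2 * n" by linarith
    then show False using assms(2) Suc n by (simp add: algebra_simps)
  qed
qed simp

section \<open>Nodes of walks, and cycles inside closed walks\<close>

context wf_digraph
begin

lemma awalk_imp_is_walk: "awalk u p v \<Longrightarrow> is_walk (u, p) \<and> wend (u, p) = v"
  by (auto simp: is_walk_def wend_def wstart_def)

text \<open>Serves to compare walks from the same start whose arcs are permuted, and to see that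
  further arcs keep \<open>k\<close> a node.\<close>

lemma nodes_eq:
  assumes "is_walk (u, p)"
  shows "nodes (u, p) = insert u (head G ` set p)"
proof -
  have w: "awalk u p (awlast u p)" using assms by (simp add: is_walk_def wend_def wstart_def)
  show ?thesis
  proof (intro set_eqI iffI)
    fix x assume "x \<in> nodes (u, p)"
    then obtain P Q where PQ: "is_walk P" "is_concat (u, p) [P, Q]" "x = wend P"
      by (auto simp: nodes_def is_concat_def)
    then have P: "fst P = u" "p = snd P @ snd Q" by (auto simp: is_concat_def wconcat_def)
    then have "awalk u (snd P) x" using PQ by (simp add: is_walk_def wstart_def)
    then show "x \<in> insert u (head G ` set p)"
      using P by (cases "snd P" rule: rev_cases) (auto simp: awalk_def cas_append_iff)
  next
    fix x assume x: "x \<in> insert u (head G ` set p)"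
    obtain q r where "p = q @ r" "awalk u q x"
    proof (cases "x = u")
      case True
      then show ?thesis using that[of "[]" p] w by (auto simp: awalk_Nil_iff)
    next
      case False
      then obtain e where e: "e \<in> set p" "x = head G e" using x by auto
      then obtain q r where "p = (q @ [e]) @ r" by (auto dest: split_list)
      then show ?thesis using that[of "q @ [e]" r] w e(2)
        by (auto simp: awalk_Cons_iff awalk_Nil_iff)
    qed
    then have "is_concat (u, p) [(u, q), (x, r)]" "wend (u, q) = x"
      using w by (auto simp: is_concat_def wconcat_def wend_def is_walk_def wstart_def)
    then show "x \<in> nodes (u, p)" unfolding nodes_def by blast
  qed
qed

text \<open>A closed walk that is not itself a cycle has a shorter nonempty closed subwalk, so
  induction on the length applies.\<close>

lemma closed_walk_contains_cycle:
  assumes "awalk w c w" "c \<noteq> []"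
  shows "\<exists>x c' y w'. c = x @ c' @ y \<and> awalk w x w' \<and> awalk w' y w \<and> is_cycle (w', c') \<and> c' \<noteq> []"
  using assms
proof (induction "length c" arbitrary: w c rule: less_induct)
  case less
  show ?case
  proof (cases "is_cycle (w, c)")
    case True
    then show ?thesis using less.prems
      by (intro exI[of _ "[]"] exI[of _ c] exI[of _ w]) (auto simp: awalk_Nil_iff)
  next
    case False
    have "is_closed (w, c)" using less.prems awalk_imp_is_walk by (auto simp: is_closed_def wstart_def)
    then obtain V A B where V: "is_concat (w, c) [A, V, B]" "V \<noteq> (w, c)" "is_closed V" "wlen V > 0"
      using False by (auto simp: is_cycle_def subwalk_def)
    obtain a v b where abv: "A = (w, a)" "snd V = v" "snd B = b" "c = a @ v @ b"
      using V(1) by (cases A) (auto simp: is_concat_def wconcat_def)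
    let ?u = "fst V"
    have a: "awalk w a ?u" and v: "awalk ?u v ?u"
      using V(1,3) abv by (auto simp: is_concat_def is_walk_def wstart_def is_closed_def wend_def)
    have b: "awalk ?u b w" using less.prems(1) a v abv(4) by auto
    \<comment> \<open>\<open>V\<close> is only known to differ from the whole walk as a pair. Were
      both sides empty, start node and arcs would agree; hence the length really drops.\<close>
    have "a \<noteq> [] \<or> b \<noteq> []"
    proof (rule ccontr)
      assume "\<not> ?thesis"
      then have "?u = w" "v = c" using a abv(4) by (auto simp: awalk_Nil_iff)
      then show False using V(2) abv(2) by (cases V) auto
    qed
    then have "length v < length c" using abv(4) by auto
    moreover have "v \<noteq> []" using V(4) abv(2) by (auto simp: wlen_def)
    ultimately obtain x c' y w' where "v = x @ c' @ y" "awalk ?u x w'" "awalk w' y ?u"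
      "is_cycle (w', c')" "c' \<noteq> []"
      using less.hyps[OF _ v] by metis
    then show ?thesis using a b abv(4)
      by (intro exI[of _ "a @ x"] exI[of _ c'] exI[of _ "y @ b"] exI[of _ w']) auto
  qed
qed

section \<open>Deleting disjoint cycles from a walk\<close>

text \<open>
  \<open>cut u p v S r\<close>: deleting the disjoint cycles \<open>S\<close> from the walk \<open>p\<close> from \<open>u\<close> to \<open>v\<close> leaves \<open>r\<close>.
\<close>

inductive cut :: "'a \<Rightarrow> 'b awalk \<Rightarrow> 'a \<Rightarrow> ('a, 'b) walk list \<Rightarrow> 'b awalk \<Rightarrow> bool" where
  cut_Nil: "u \<in> verts G \<Longrightarrow> cut u [] u [] []"
| cut_arc: "cut (head G e) p v S r \<Longrightarrow> e \<in> arcs G \<Longrightarrow> cut (tail G e) (e # p) v S (e # r)"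
| cut_cycle: "cut u p v S r \<Longrightarrow> is_cycle (u, c) \<Longrightarrow> c \<noteq> [] \<Longrightarrow> cut u (c @ p) v ((u, c) # S) r"

lemma is_cycle_awalk: "is_cycle (u, c) \<Longrightarrow> awalk u c u"
  by (auto simp: is_cycle_def is_closed_def is_walk_def wstart_def)

lemma cut_awalks: "cut u p v S r \<Longrightarrow> awalk u p v \<and> awalk u r v"
  by (induction rule: cut.induct)
    (auto simp: awalk_Nil_iff awalk_Cons_iff dest: is_cycle_awalk)

lemma cut_cycles: "cut u p v S r \<Longrightarrow> C \<in> set S \<Longrightarrow> is_cycle C \<and> wlen C > 0"
  by (induction rule: cut.induct) (auto simp: wlen_def)

lemma cut_refl: "awalk u p v \<Longrightarrow> cut u p v [] p"
  by (induction p arbitrary: u) (auto simp: awalk_Nil_iff awalk_Cons_iff intro: cut.intros)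

lemma cut_append:
  "cut u p v S r \<Longrightarrow> cut v q w T s \<Longrightarrow> cut u (p @ q) w (S @ T) (r @ s)"
  by (induction rule: cut.induct) (auto intro: cut.intros)

text \<open>A cycle of \<open>S\<close> not selected in \<open>T\<close> is put back as ordinary
  arcs, which only adds arcs to the remainder.\<close>

lemma cut_subseq:
  assumes "cut u p v S r" "subseq T S"
  shows "\<exists>r'. cut u p v T r' \<and> set r \<subseteq> set r'"
  using assms
proof (induction arbitrary: T rule: cut.induct)
  case (cut_Nil u)
  then show ?case using list_emb_Nil2 by (blast intro: cut.cut_Nil)
next
  case (cut_arc e p v S r)
  then obtain r' where "cut (head G e) p v T r'" "set r \<subseteq> set r'" by blast
  then show ?case using cut_arc.hyps by (intro exI[of _ "e # r'"]) (auto intro: cut.cut_arc)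
next
  case (cut_cycle u p v S r c)
  show ?case
  proof (cases "subseq T S")
    case True
    then obtain r' where r': "cut u p v T r'" "set r \<subseteq> set r'" using cut_cycle.IH by blast
    then have "cut u (c @ p) v ([] @ T) (c @ r')"
      using cut_cycle.hyps(2) is_cycle_awalk cut_refl cut_append by blast
    then show ?thesis using r' by (intro exI[of _ "c @ r'"]) auto
  next
    case False
    then obtain T' where T': "T = (u, c) # T'" "subseq T' S"
      using cut_cycle.prems by (cases T) (auto simp: subseq_Cons2_iff split: if_splits)
    then obtain r' where "cut u p v T' r'" "set r \<subseteq> set r'" using cut_cycle.IH by blast
    then show ?thesis using T' cut_cycle.hyps by (auto intro: cut.cut_cycle)
  qed
qed

text \<open>An arc lengthens the first factor of the decomposition; a cycle at the front is preceded
  by a new empty factor.\<close>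

lemma cut_decomposes:
  "cut u p v S r \<Longrightarrow> \<exists>Us. decomposes (u, p) S Us \<and> concat (map snd Us) = r"
proof (induction rule: cut.induct)
  case (cut_Nil u)
  then show ?case
    using decomposes_Nil_iff[of "(u, [])"] awalk_imp_is_walk[of u "[]" u]
    by (intro exI[of _ "[(u, [])]"]) (auto simp: awalk_Nil_iff)
next
  case (cut_arc e p v S r)
  then obtain Us where Us: "decomposes (head G e, p) S Us" "concat (map snd Us) = r" by blast
  then obtain U Us' where U: "Us = (head G e, U) # Us'"
    by (cases Us) (auto simp: decomposes_def is_concat_def wconcat_def)
  have "wend (tail G e, e # U) = wend (head G e, U)" by (simp add: wend_def)
  moreover have "is_walk (head G e, U) \<Longrightarrow> is_walk (tail G e, e # U)"
    using cut_arc.hyps(2) by (auto simp: is_walk_def wend_def wstart_def awalk_Cons_iff)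
  ultimately have "decomposes (tail G e, e # p) S ((tail G e, e # U) # Us')"
    using Us(1) U by (cases S)
      (auto simp: decomposes_def is_concat_def wconcat_def successively_Cons)
  then show ?case using Us(2) U by auto
next
  case (cut_cycle u p v S r c)
  then obtain Us where Us: "decomposes (u, p) S Us" "concat (map snd Us) = r" by blast
  have u: "awalk u c u" "u \<in> verts G" using cut_cycle.hyps(2) is_cycle_awalk by auto
  then have "decomposes (u, c @ p) ((u, c) # S) ((u, []) # Us)"
    using Us(1) awalk_imp_is_walk[of u c u] awalk_imp_is_walk[of u "[]" u]
    by (cases Us) (auto simp: decomposes_def is_concat_def wconcat_def successively_Cons
        wstart_def awalk_Nil_iff)
  then show ?case using Us(2) by (intro exI[of _ "(u, []) # Us"]) auto
qed

lemma cut_in_patterns_mod_at: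
  assumes "decomp_choice D" "cut u p v S r" "k \<in> nodes (u, r)" "d dvd pattern_len S"
  shows "S \<in> patterns_mod_at D d k (u, p)"
proof -
  have w: "is_walk (u, p)" "is_walk (u, r)"
    using cut_awalks[OF assms(2)] awalk_imp_is_walk by auto
  obtain Us where Us: "decomposes (u, p) S Us" "concat (map snd Us) = r"
    using cut_decomposes[OF assms(2)] by blast
  have pat: "cycle_pattern (u, p) S"
    using Us(1) cut_cycles[OF assms(2)] by (auto simp: cycle_pattern_def)
  then have D: "decomposes (u, p) S (D (u, p) S)"
    using assms(1) w(1) by (auto simp: decomp_choice_def)
  have p: "mset p = mset (concat (map snd Vs)) + mset (concat (map snd S))" "fst (hd Vs) = u"
    if "decomposes (u, p) S Vs" for Vs
    using that mset_concat_splice[of snd Vs S]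
    by (cases Vs; auto simp: decomposes_def is_concat_def wconcat_def)+
  \<comment> \<open>\<open>D\<close> may locate the cycles elsewhere than \<open>cut\<close> did,
    but both decompositions lose the same arcs.\<close>
  have "mset (concat (map snd (D (u, p) S))) = mset r"
    using p(1)[OF D] p(1)[OF Us(1)] Us(2) by (metis add_right_cancel)
  then obtain r' where r': "Rem D (u, p) S = (u, r')" "set r' = set r"
    using p(2)[OF D] by (metis Rem_def wconcat_def mset_eq_setD)
  have "is_walk (u, r')" using Rem_is_walk(1)[OF assms(1) w(1) pat] r' by simp
  then have "k \<in> nodes (Rem D (u, p) S)" using assms(3) w(2) r' by (simp add: nodes_eq)
  then show ?thesis
    using pat assms(4) by (simp add: patterns_mod_at_def patterns_at_def cong_0_iff)
qed

section \<open>Fixed points of the reduction step\<close>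

lemma Red_fixpoint:
  assumes "decomp_choice D" "pattern_choice D M" "d > 0" "is_walk W" "k \<in> nodes W"
  shows "is_walk (Red D M d k W)" "k \<in> nodes (Red D M d k W)"
    "Step D M d k (Red D M d k W) = Red D M d k W"
proof -
  obtain n where n: "\<And>t. t \<ge> n \<Longrightarrow> (Step D M d k ^^ t) W = Red D M d k W"
    using Red_stationary[OF assms] by (auto simp: eventually_sequentially)
  have "is_walk ((Step D M d k ^^ t) W) \<and> k \<in> nodes ((Step D M d k ^^ t) W)" for t
    by (induction t) (use assms Step_props in auto)
  then show "is_walk (Red D M d k W)" "k \<in> nodes (Red D M d k W)"
    using n by (metis order_refl)+
  show "Step D M d k (Red D M d k W) = Red D M d k W"
    using n[of n] n[of "Suc n"] by simp
qed

text \<open>The chosen pattern removes no arcs from a fixed point, and its maximality bounds all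
  others by 0.\<close>

lemma Step_fixpoint_pattern_len:
  assumes "decomp_choice D" "pattern_choice D M" "d > 0" "is_walk W" "k \<in> nodes W"
    and "Step D M d k W = W" "S \<in> patterns_mod_at D d k W"
  shows "pattern_len S = 0"
proof -
  have max: "is_arg_max pattern_len (\<lambda>S. S \<in> patterns_mod_at D d k W) (M d k W)"
    using assms unfolding pattern_choice_def by blast
  then have "cycle_pattern W (M d k W)"
    by (auto simp: is_arg_max_def patterns_mod_at_def patterns_at_def)
  then have "pattern_len (M d k W) = 0"
    using Rem_is_walk(2)[OF assms(1,4)] assms(6) by (fastforce simp: Step_def)
  then show ?thesis using max assms(7) by (auto simp: is_arg_max_linorder)
qed

end

section \<open>Cycles in long walks of a finite digraph, and the length bound\<close>

context fin_digraph
begin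

text \<open>A walk with as many arcs as there are nodes visits one node too many, so some node
  repeats and encloses a nonempty closed walk.\<close>

lemma long_walk_contains_cycle:
  assumes "awalk u p v" "length p = card (verts G)"
  shows "\<exists>x c y w. p = x @ c @ y \<and> awalk u x w \<and> awalk w y v \<and> is_cycle (w, c) \<and> c \<noteq> []"
proof -
  have "\<not> distinct (awalk_verts u p)"
  proof
    assume "distinct (awalk_verts u p)"
    then have "length (awalk_verts u p) \<le> card (verts G)"
      using assms(1) finite_verts by (metis awalkE' card_mono distinct_card)
    then show False using assms(2) by (simp add: length_awalk_verts)
  qed
  then obtain q r s w where "p = q @ r @ s" "awalk u q w" "awalk w r w" "awalk w s v" "r \<noteq> []"
    using awalk_not_distinct_decomp[OF assms(1)] by auto
  moreover obtain x c y w' where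
    "r = x @ c @ y" "awalk w x w'" "awalk w' y w" "is_cycle (w', c)" "c \<noteq> []"
    using closed_walk_contains_cycle[OF \<open>awalk w r w\<close> \<open>r \<noteq> []\<close>] by metis
  ultimately show ?thesis
    by (intro exI[of _ "q @ x"] exI[of _ c] exI[of _ "y @ s"] exI[of _ w']) auto
qed

lemma ex_cut_length:
  assumes "awalk u p v" "n * card (verts G) \<le> length p"
  shows "\<exists>S r. cut u p v S r \<and> length S = n"
  using assms
proof (induction n arbitrary: u p)
  case 0
  then show ?case using cut_refl by auto
next
  case (Suc n)
  let ?N = "card (verts G)"
  obtain w where w: "awalk u (take ?N p) w" "awalk w (drop ?N p) v"
    using Suc.prems(1) by (metis append_take_drop_id awalk_append_iff)
  then obtain x c y z where xcy: "take ?N p = x @ c @ y" "awalk u x z" "awalk z y w"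
    "is_cycle (z, c)" "c \<noteq> []"
    using long_walk_contains_cycle[OF w(1)] Suc.prems(2) by auto
  \<comment> \<open>The rest \<open>y\<close> of the block behind the cycle is handed on to the
    recursion, so that the remaining walk starts at the base \<open>z\<close> of the cycle, as
    \<open>cut_cycle\<close> demands.\<close>
  have "awalk z (y @ drop ?N p) v" using xcy w by auto
  moreover have "n * ?N \<le> length (y @ drop ?N p)" using Suc.prems(2) by simp
  ultimately obtain S r where S: "cut z (y @ drop ?N p) v S r" "length S = n"
    using Suc.IH by blast
  have "cut u (x @ c @ y @ drop ?N p) v ([] @ (z, c) # S) (x @ r)"
    using cut_append[OF cut_refl[OF xcy(2)] cut_cycle[OF S(1) xcy(4,5)]] .
  moreover have "x @ c @ y @ drop ?N p = p" using xcy(1) by (metis append_assoc append_take_drop_id)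
  ultimately show ?case using S(2) by auto
qed

lemma Step_fixpoint_length:
  assumes D: "decomp_choice D" and M: "pattern_choice D M" and d: "d > 0"
    and W: "is_walk W" and k: "k \<in> nodes W" and stat: "Step D M d k W = W"
  shows "wlen W \<le> (d - 1) + 2 * d * (card (verts G) - 1)"
proof (rule ccontr)
  assume long: "\<not> ?thesis"
  let ?N = "card (verts G)"
  obtain P Q where PQ: "is_concat W [P, Q]" "k = wend P" using k by (auto simp: nodes_def)
  obtain u a b where ab: "P = (u, a)" "snd Q = b" "W = (u, a @ b)"
    using PQ by (cases P) (auto simp: is_concat_def wconcat_def)
  define v where "v = wend Q"
  have a: "awalk u a k" and b: "awalk k b v"
    using PQ ab by (auto simp: is_concat_def is_walk_def wstart_def v_def)
  have "?N > 0" using a finite_verts by (auto simp: card_gt_0_iff)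
  then have dN: "d \<le> length a div ?N + length b div ?N"
    using long d ab(3) by (intro le_div_add_div) (auto simp: wlen_def)
  obtain S r where S: "cut u a k S r" "length S = length a div ?N"
    using ex_cut_length[OF a, of "length a div ?N"] by auto
  obtain T s where T: "cut k b v T s" "length T = length b div ?N"
    using ex_cut_length[OF b, of "length b div ?N"] by auto
  have ST: "cut u (a @ b) v (S @ T) (r @ s)" using S(1) T(1) by (rule cut_append)
  \<comment> \<open>There may be more than \<open>d\<close> cycles, while the pigeonhole lemma takes
    exactly \<open>d\<close>.\<close>
  obtain X where X: "subseq X (take d (S @ T))" "X \<noteq> []" "d dvd pattern_len X"
    unfolding pattern_len_def using ex_subseq_sum_dvd[OF d] S(2) T(2) dN
    by (metis length_append length_take min.absorb2)
  have "subseq X (S @ T)"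
    using X(1) by (meson subseq_order.trans sublist_imp_subseq sublist_take)
  then obtain t where t: "cut u (a @ b) v X t" "set (r @ s) \<subseteq> set t" using cut_subseq[OF ST] by blast
  \<comment> \<open>As \<open>a\<close> and \<open>b\<close> were cut separately, \<open>r\<close>
    still ends at \<open>k\<close>: either it is empty and \<open>k\<close> is \<open>u\<close>, or
    its last arc has head \<open>k\<close>.\<close>
  have "k \<in> insert u (head G ` set r)"
    using cut_awalks[OF S(1)] by (cases r rule: rev_cases) (auto simp: awalk_def cas_append_iff)
  then have "k \<in> nodes (u, t)"
    using t cut_awalks[OF t(1)] awalk_imp_is_walk nodes_eq by auto
  then have "pattern_len X = 0"
    using Step_fixpoint_pattern_len[OF D M d W k stat] cut_in_patterns_mod_at[OF D t(1) _ X(3)] ab(3)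
    by simp
  moreover have "pattern_len X > 0"
    using X(2) cut_cycles[OF t(1)] by (cases X) (auto simp: pattern_len_def)
  ultimately show False by simp
qed

end

theorem theorem2:
  fixes G :: "'a pair_pre_digraph"
    and D :: "('a, 'a \<times> 'a) walk \<Rightarrow> ('a, 'a \<times> 'a) walk list \<Rightarrow> ('a, 'a \<times> 'a) walk list"
    and M :: "nat \<Rightarrow> 'a \<Rightarrow> ('a, 'a \<times> 'a) walk \<Rightarrow> ('a, 'a \<times> 'a) walk list"
    and N d :: nat and k :: 'a and W :: "('a, 'a \<times> 'a) walk"
  assumes "pair_fin_digraph G"
    and "card (pverts G) = N"
    and "pre_digraph.decomp_choice (with_proj G) D"
    and "pre_digraph.pattern_choice (with_proj G) D M"
    and "d > 0"
    and "k \<in> pverts G"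
    and "pre_digraph.is_walk (with_proj G) W"
    and "k \<in> pre_digraph.nodes (with_proj G) W"
  shows "wlen (Red D M d k W) \<le> (d - 1) + 2 * d * (N - 1)"
proof -
  interpret pair_fin_digraph G by (rule assms(1))
  \<comment> \<open>The reduction is itself a fixed point through \<open>k\<close>, so the bound for
    fixed points applies to it.\<close>
  show ?thesis
    using Step_fixpoint_length[OF assms(3-5) Red_fixpoint[OF assms(3-5,7,8)]] assms(2) by simp
qed

end
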